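(* Let $\Gamma$ be a cofinite graph and let $\overline\Gamma$ be its completion (as a cofinite directed graph). Then $\overline\Gamma$ has a unique involution making it into a cofinite graph such that $\Gamma$ is a subgraph. Moreover, the cofinite graph entourages of $\overline\Gamma$ are precisely the closures $\overline R$ in $\overline\Gamma\times\overline\Gamma$ of all cofinite graph entourages $R$ of $\Gamma$.
   Context: A directed graph is a set $\Gamma$ with a distinguished subset $V(\Gamma)$ and two functions $s,t\colon\Gamma\to V(\Gamma)$ satisfying $s(x)=t(x)=x$ for all $x\in V(\Gamma)$. A sub-directed graph is a subset closed under $s$ and $t$. A topological directed graph is a directed graph with a topology such that $s,t\colon\Gamma\to V(\Gamma)$ are continuous ($V(\Gamma)$ with the subspace topology). A graph is a directed graph $\Gamma$ equipped with a map $x\mapsto x^{-1}$, $\Gamma\to\Gamma$ (its involution), such that $s(x^{-1})=t(x)$, $t(x^{-1})=s(x)$, $(x^{-1})^{-1}=x$, and $x^{-1}=x$ if and only if $x\in V(\Gamma)$. A subgraph of a graph is a sub-directed graph closed under the involution (with the restricted involution). A map of graphs is a function preserving sources, targets and inverses. An equivalence relation $R$ on a graph $\Gamma$ is a graph equivalence relation if $\Gamma/R$ admits the structure of a graph such that the natural map $\Gamma\to\Gamma/R$ is a map of graphs; equivalently: (i) $(x,y)\in R$ implies $(s(x),s(y)),(t(x),t(y)),(x^{-1},y^{-1})\in R$, and (ii) if $(x,x^{-1})\in R$ then $(v,x)\in R$ for some $v\in V(\Gamma)$. For a graph with a uniformity, a cofinite graph entourage is a graph equivalence relation of finite index (finitely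 many classes) which is also an entourage. A cofinite graph is a graph endowed with a Hausdorff uniformity that has a base consisting of cofinite graph entourages. A cofinite graph is in particular a cofinite directed graph, i.e. a directed graph endowed with a Hausdorff uniformity having a base of entourages that are equivalence relations of finite index compatible with $s$ and $t$. Every compact Hausdorff space is regarded as a uniform space with the unique uniformity inducing its topology. The completion of a cofinite directed graph $\Gamma$ is the compact Hausdorff topological directed graph $\overline\Gamma$ that contains $\Gamma$ as a dense uniform sub-directed graph (dense, and with the uniformity of $\Gamma$ induced from $\overline\Gamma$); it exists and is unique up to isomorphism of topological directed graphs extending the identity on $\Gamma$. *)

theory Defs
  imports "HOL-Analysis.Analysis"
begin

section \<open>Directed graphs and graphs\<close>

text \<open>Vertices are themselves elements of the graph.  The functions \<open>src\<close>, \<open>tgt\<close> and the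
  involutions are total HOL functions of which only the values on \<open>points\<close> are meaningful.\<close>

record 'a digraph =
  points :: "'a set"
  verts :: "'a set"
  src :: "'a \<Rightarrow> 'a"
  tgt :: "'a \<Rightarrow> 'a"

definition directed_graph :: "'a digraph \<Rightarrow> bool" where
  "directed_graph G \<longleftrightarrow>
     verts G \<subseteq> points G \<and>
     src G \<in> points G \<rightarrow> verts G \<and> tgt G \<in> points G \<rightarrow> verts G \<and>
     (\<forall>x\<in>verts G. src G x = x \<and> tgt G x = x)"

text \<open>The conditions on \<open>verts\<close>, \<open>src\<close> and \<open>tgt\<close> say that \<open>H\<close> carries the structure inherited
  from \<open>G\<close>; closure under \<open>src G\<close> and \<open>tgt G\<close> is then part of \<open>directed_graph H\<close>.\<close>

definition sub_digraph :: "'a digraph \<Rightarrow> 'a digraph \<Rightarrow> bool" where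
  "sub_digraph H G \<longleftrightarrow>
     directed_graph H \<and> directed_graph G \<and>
     points H \<subseteq> points G \<and> verts H = verts G \<inter> points H \<and>
     (\<forall>x\<in>points H. src H x = src G x \<and> tgt H x = tgt G x)"

definition is_graph :: "'a digraph \<Rightarrow> ('a \<Rightarrow> 'a) \<Rightarrow> bool" where
  "is_graph G i \<longleftrightarrow>
     directed_graph G \<and> i \<in> points G \<rightarrow> points G \<and>
     (\<forall>x\<in>points G. src G (i x) = tgt G x \<and> tgt G (i x) = src G x \<and> i (i x) = x \<and>
                     (i x = x \<longleftrightarrow> x \<in> verts G))"

definition subgraph :: "'a digraph \<Rightarrow> ('a \<Rightarrow> 'a) \<Rightarrow> 'a digraph \<Rightarrow> ('a \<Rightarrow> 'a) \<Rightarrow> bool" where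
  "subgraph H i G j \<longleftrightarrow>
     is_graph H i \<and> is_graph G j \<and> sub_digraph H G \<and> (\<forall>x\<in>points H. i x = j x)"

definition graph_map ::
    "'a digraph \<Rightarrow> ('a \<Rightarrow> 'a) \<Rightarrow> 'b digraph \<Rightarrow> ('b \<Rightarrow> 'b) \<Rightarrow> ('a \<Rightarrow> 'b) \<Rightarrow> bool" where
  "graph_map G i H j f \<longleftrightarrow>
     f \<in> points G \<rightarrow> points H \<and>
     (\<forall>x\<in>points G. f (src G x) = src H (f x) \<and> f (tgt G x) = tgt H (f x) \<and> f (i x) = j (f x))"

definition graph_equiv :: "'a digraph \<Rightarrow> ('a \<Rightarrow> 'a) \<Rightarrow> ('a \<times> 'a) set \<Rightarrow> bool" where
  "graph_equiv G i R \<longleftrightarrow>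
     equiv (points G) R \<and>
     (\<exists>Q j. points Q = points G // R \<and> is_graph Q j \<and> graph_map G i Q j (\<lambda>x. R `` {x}))"

lemma graph_equiv_iff:
  assumes "is_graph G i"
  shows "graph_equiv G i R \<longleftrightarrow>
     equiv (points G) R \<and>
     (\<forall>(x, y)\<in>R. (src G x, src G y) \<in> R \<and> (tgt G x, tgt G y) \<in> R \<and> (i x, i y) \<in> R) \<and>
     (\<forall>x. (x, i x) \<in> R \<longrightarrow> (\<exists>v\<in>verts G. (v, x) \<in> R))"
proof (intro iffI conjI)
  assume L: "graph_equiv G i R"
  then show eq: "equiv (points G) R"
    by (simp add: graph_equiv_def)
  from L obtain Q j where Q: "points Q = points G // R" "is_graph Q j"
    and f: "graph_map G i Q j (\<lambda>x. R `` {x})"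
    by (auto simp: graph_equiv_def)
  have G: "src G x \<in> verts G" "tgt G x \<in> verts G" "src G x \<in> points G" "tgt G x \<in> points G"
    "i x \<in> points G" if "x \<in> points G" for x
    using assms that by (auto simp: is_graph_def directed_graph_def)
  have mp: "R `` {src G x} = src Q (R `` {x})" "R `` {tgt G x} = tgt Q (R `` {x})"
    "R `` {i x} = j (R `` {x})" "R `` {x} \<in> points Q" if "x \<in> points G" for x
    using f that by (auto simp: graph_map_def)
  have R: "(x, y) \<in> R \<longleftrightarrow> x \<in> points G \<and> y \<in> points G \<and> R `` {x} = R `` {y}" for x y
    using eq by (metis eq_equiv_class_iff equiv_class_eq_iff)
  show "\<forall>(x, y)\<in>R. (src G x, src G y) \<in> R \<and> (tgt G x, tgt G y) \<in> R \<and> (i x, i y) \<in> R"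
    using R G mp by fastforce
  show "\<forall>x. (x, i x) \<in> R \<longrightarrow> (\<exists>v\<in>verts G. (v, x) \<in> R)"
  proof (intro allI impI)
    fix x assume x: "(x, i x) \<in> R"
    then have xG: "x \<in> points G" and "j (R `` {x}) = R `` {x}"
      using R mp by metis+
    then have "R `` {x} \<in> verts Q"
      using Q mp(4) by (metis is_graph_def)
    then have "src Q (R `` {x}) = R `` {x}"
      using Q by (simp add: is_graph_def directed_graph_def)
    then have "(src G x, x) \<in> R"
      using R G xG mp by simp
    then show "\<exists>v\<in>verts G. (v, x) \<in> R"
      using G xG by blast
  qed
next
  assume A: "equiv (points G) R \<and>
     (\<forall>(x, y)\<in>R. (src G x, src G y) \<in> R \<and> (tgt G x, tgt G y) \<in> R \<and> (i x, i y) \<in> R) \<and>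
     (\<forall>x. (x, i x) \<in> R \<longrightarrow> (\<exists>v\<in>verts G. (v, x) \<in> R))"
  define r where "r c = (SOME x. x \<in> c)" for c :: "'a set"
  define Q where "Q = \<lparr>points = points G // R, verts = (\<lambda>x. R `` {x}) ` verts G,
    src = (\<lambda>c. R `` {src G (r c)}), tgt = (\<lambda>c. R `` {tgt G (r c)})\<rparr>"
  define j where "j c = R `` {i (r c)}" for c
  have eq: "equiv (points G) R" using A by blast
  have R: "(x, y) \<in> R \<longleftrightarrow> x \<in> points G \<and> y \<in> points G \<and> R `` {x} = R `` {y}" for x y
    using eq by (metis eq_equiv_class_iff equiv_class_eq_iff)
  have r: "(x, r (R `` {x})) \<in> R" if "x \<in> points G" for x
  proof -
    have "r (R `` {x}) \<in> R `` {x}"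
      unfolding r_def using equiv_class_self[OF eq that] by (rule someI)
    then show ?thesis by simp
  qed
  have G: "src G x \<in> verts G" "tgt G x \<in> verts G" "src G x \<in> points G" "tgt G x \<in> points G"
    "i x \<in> points G" "src G (i x) = tgt G x" "tgt G (i x) = src G x" "i (i x) = x"
    "i x = x \<longleftrightarrow> x \<in> verts G" if "x \<in> points G" for x
    using assms that by (auto simp: is_graph_def directed_graph_def)
  have V: "x \<in> points G" "src G x = x" "tgt G x = x" if "x \<in> verts G" for x
    using assms that by (auto simp: is_graph_def directed_graph_def)
  have Qs: "src Q (R `` {x}) = R `` {src G x}" "tgt Q (R `` {x}) = R `` {tgt G x}"
    "j (R `` {x}) = R `` {i x}" if "x \<in> points G" for x
  proof -
    have "(src G x, src G (r (R `` {x}))) \<in> R" "(tgt G x, tgt G (r (R `` {x}))) \<in> R"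
      "(i x, i (r (R `` {x}))) \<in> R"
      using r[OF that] A by blast+
    then show "src Q (R `` {x}) = R `` {src G x}" "tgt Q (R `` {x}) = R `` {tgt G x}"
      "j (R `` {x}) = R `` {i x}"
      by (simp_all add: Q_def j_def equiv_class_eq[OF eq])
  qed
  have Qp: "c \<in> points Q \<longleftrightarrow> (\<exists>x\<in>points G. c = R `` {x})" for c
    by (auto simp: Q_def quotient_def)
  have Qv: "c \<in> verts Q \<longleftrightarrow> (\<exists>x\<in>verts G. c = R `` {x})" for c
    by (auto simp: Q_def)
  have fixd: "R `` {i x} = R `` {x} \<longleftrightarrow> (\<exists>v\<in>verts G. R `` {x} = R `` {v})" if "x \<in> points G" for x
  proof
    assume "R `` {i x} = R `` {x}"
    then have "(x, i x) \<in> R" using R G that by simp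
    then show "\<exists>v\<in>verts G. R `` {x} = R `` {v}" using A R by metis
  next
    assume "\<exists>v\<in>verts G. R `` {x} = R `` {v}"
    then obtain v where v: "v \<in> verts G" "R `` {x} = R `` {v}" by blast
    then have "(v, x) \<in> R" using R V that by simp
    then have "(i v, i x) \<in> R" using A by blast
    then show "R `` {i x} = R `` {x}" using R G V v by metis
  qed
  have "directed_graph Q"
    unfolding directed_graph_def Pi_iff
    using G V Qs by (auto simp: Qp Qv) blast+
  then have "is_graph Q j"
    unfolding is_graph_def Pi_iff using G V Qs fixd by (auto simp: Qp Qv) metis+
  moreover have "graph_map G i Q j (\<lambda>x. R `` {x})"
    unfolding graph_map_def Pi_iff using Qs by (auto simp: Qp)
  moreover have "points Q = points G // R" by (simp add: Q_def)
  ultimately show "graph_equiv G i R"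
    using eq unfolding graph_equiv_def by blast
qed

section \<open>Cofinite graphs\<close>

text \<open>A subset \<open>X\<close> of a uniform space carries the induced uniformity \<open>uniformity_on X\<close>, whose
  topology is the subspace topology \<open>top_of_set X\<close>.\<close>

definition entourage_on :: "'a::uniform_space set \<Rightarrow> ('a \<times> 'a) set \<Rightarrow> bool" where
  "entourage_on X E \<longleftrightarrow> E \<subseteq> X \<times> X \<and> eventually (\<lambda>p. p \<in> E) (uniformity_on X)"

definition cofinite_graph_entourage ::
    "'a::uniform_space digraph \<Rightarrow> ('a \<Rightarrow> 'a) \<Rightarrow> ('a \<times> 'a) set \<Rightarrow> bool" where
  "cofinite_graph_entourage G i R \<longleftrightarrow>
     graph_equiv G i R \<and> finite (points G // R) \<and> entourage_on (points G) R"

definition cofinite_graph :: "'a::uniform_space digraph \<Rightarrow> ('a \<Rightarrow> 'a) \<Rightarrow> bool" where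
  "cofinite_graph G i \<longleftrightarrow>
     is_graph G i \<and> Hausdorff_space (top_of_set (points G)) \<and>
     (\<forall>E. entourage_on (points G) E \<longrightarrow> (\<exists>R. cofinite_graph_entourage G i R \<and> R \<subseteq> E))"

text \<open>\<open>G\<close> has the uniformity induced from \<open>C\<close> because both have the one induced from the ambient
  type.  The uniformity \<open>uniformity_on (points C)\<close> induces the compact Hausdorff topology of \<open>C\<close>,
  hence is the only uniformity that does so.\<close>

definition completion_of :: "'a::uniform_space digraph \<Rightarrow> 'a digraph \<Rightarrow> bool" where
  "completion_of G C \<longleftrightarrow>
     sub_digraph G C \<and>
     compact (points C) \<and> Hausdorff_space (top_of_set (points C)) \<and>
     continuous_on (points C) (src C) \<and> continuous_on (points C) (tgt C) \<and>
     points C \<subseteq> closure (points G)"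

end

theory Submission
  imports Defs
begin

text \<open>The closures of the cofinite graph entourages of \<open>\<Gamma>\<close> are equivalence relations that form a base
  of entourages of the completion, and each of them restricts to the original entourage on \<open>\<Gamma>\<close>.
  Two points are therefore equal if all these closures relate them, so every identity needed for the
  extended involution \<open>j\<close> can be transferred from nearby points of \<open>\<Gamma>\<close>.  The graph of \<open>j\<close> is the
  closure of the graph of the involution of \<open>\<Gamma>\<close>: by compactness it projects onto the
  completion, and it is single-valued because the involution preserves a base of entourages.\<close>

section \<open>Closures of entourages of a dense subspace\<close>

abbreviation closure2 :: "'a::topological_space set \<Rightarrow> ('a \<times> 'a) set \<Rightarrow> ('a \<times> 'a) set" where
  "closure2 X R \<equiv> top_of_set (X \<times> X) closure_of R"

section \<open>Entourages, symmetric refinements and closures in the square\<close>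

lemma entourage_on_iff:
  "entourage_on X E \<longleftrightarrow> E \<subseteq> X \<times> X \<and> eventually (\<lambda>p. p \<in> X \<times> X \<longrightarrow> p \<in> E) uniformity"
  by (simp add: entourage_on_def eventually_inf_principal)

lemma entourage_onE:
  assumes "entourage_on X E"
  obtains P where "eventually P uniformity"
    "\<And>x y. P (x, y) \<Longrightarrow> x \<in> X \<Longrightarrow> y \<in> X \<Longrightarrow> (x, y) \<in> E"
  using assms unfolding entourage_on_iff by blast

text \<open>Halving \<open>E\<close> twice and symmetrising. The three-step clause serves chains
  from a point to its approximant, across, and back. The two-step clause compares two approximants
  of one point.\<close>

lemma uniformity_thirdE:
  fixes E :: "'a::uniform_space \<times> 'a \<Rightarrow> bool"
  assumes "eventually E uniformity"
  obtains D where "eventually D uniformity" "\<And>x y. D (x, y) \<Longrightarrow> D (y, x)"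
    "\<And>x y z. D (x, y) \<Longrightarrow> D (y, z) \<Longrightarrow> E (x, z)"
    "\<And>w x y z. D (w, x) \<Longrightarrow> D (x, y) \<Longrightarrow> D (y, z) \<Longrightarrow> E (w, z)"
proof -
  obtain A where A: "eventually A uniformity" "\<And>x y z. A (x, y) \<Longrightarrow> A (y, z) \<Longrightarrow> E (x, z)"
    using uniformity_transE[OF assms] by blast
  obtain B where B: "eventually B uniformity" "\<And>x y z. B (x, y) \<Longrightarrow> B (y, z) \<Longrightarrow> A (x, z)"
    using uniformity_transE[OF A(1)] by blast
  have BA: "A (x, y)" if "B (x, y)" for x y
    using B that uniformity_refl[OF B(1)] by blast
  define D where "D = (\<lambda>(x, y). B (x, y) \<and> B (y, x))"
  have "eventually D uniformity"
    using eventually_conj[OF B(1) uniformity_sym[OF B(1)]]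
    by (simp add: D_def case_prod_unfold)
  then show thesis
  proof (rule that)
    show "E (w, z)" if "D (w, x)" "D (x, y)" "D (y, z)" for w x y z
      using that A(2)[of w y z] B(2)[of w x y] BA[of y z] by (simp add: D_def)
    show "E (x, z)" if "D (x, y)" "D (y, z)" for x y z
      using that A(2)[of x y z] BA[of x y] BA[of y z] by (simp add: D_def)
  qed (simp add: D_def)
qed

lemma eventually_nhds_uniformityI:
  "eventually P uniformity \<Longrightarrow> eventually (\<lambda>y. P (x, y)) (nhds (x::'a::uniform_space))"
  unfolding eventually_nhds_uniformity by (erule eventually_mono) auto

text \<open>Product neighbourhoods of \<open>(x, y)\<close> can be measured by a single entourage
  \<open>P\<close> on both coordinates, because finitely many entourages can be intersected.
  Closures thus become purely uniform.\<close>

lemma in_closure2_iff: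
  fixes X :: "'a::uniform_space set"
  assumes "R \<subseteq> X \<times> X" "x \<in> X" "y \<in> X"
  shows "(x, y) \<in> closure2 X R \<longleftrightarrow>
    (\<forall>P. eventually P uniformity \<longrightarrow> (\<exists>(x', y')\<in>R. P (x, x') \<and> P (y, y')))"
proof (intro iffI allI impI)
  fix P :: "'a \<times> 'a \<Rightarrow> bool" assume cl: "(x, y) \<in> closure2 X R" and P: "eventually P uniformity"
  obtain A where A: "open A" "x \<in> A" "\<And>a. a \<in> A \<Longrightarrow> P (x, a)"
    using eventually_nhds_uniformityI[OF P, of x] unfolding eventually_nhds by blast
  obtain B where B: "open B" "y \<in> B" "\<And>b. b \<in> B \<Longrightarrow> P (y, b)"
    using eventually_nhds_uniformityI[OF P, of y] unfolding eventually_nhds by blast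
  have "openin (top_of_set (X \<times> X)) ((X \<times> X) \<inter> A \<times> B)"
    using A B by (simp add: openin_open_Int open_Times)
  moreover have "(x, y) \<in> (X \<times> X) \<inter> A \<times> B"
    using A(2) B(2) assms(2,3) by blast
  ultimately obtain p where "p \<in> R" "p \<in> (X \<times> X) \<inter> A \<times> B"
    using cl unfolding in_closure_of by (metis (no_types, lifting))
  then show "\<exists>(x', y')\<in>R. P (x, x') \<and> P (y, y')"
    using A(3) B(3) by blast
next
  assume near: "\<forall>P. eventually P uniformity \<longrightarrow> (\<exists>(x', y')\<in>R. P (x, x') \<and> P (y, y'))"
  have "\<exists>p\<in>R. p \<in> T" if T: "(x, y) \<in> T" "openin (top_of_set (X \<times> X)) T" for T
  proof -
    obtain W where W: "open W" "T = X \<times> X \<inter> W"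
      using T by (auto simp: openin_open)
    obtain A B where AB: "open A" "open B" "x \<in> A" "y \<in> B" "A \<times> B \<subseteq> W"
      using open_prod_elim[OF W(1), of "(x, y)"] T(1) unfolding W(2)
      by (metis Int_iff mem_Sigma_iff)
    \<comment> \<open>A neighbourhood of one point is an entourage that constrains only pairs
      starting at that point. Intersecting the two handles \<open>x = y\<close> as well.\<close>
    have "eventually (\<lambda>(a, b). a = x \<longrightarrow> b \<in> A) uniformity"
      "eventually (\<lambda>(a, b). a = y \<longrightarrow> b \<in> B) uniformity"
      using AB eventually_nhds_uniformity[of "\<lambda>b. b \<in> A" x]
        eventually_nhds_uniformity[of "\<lambda>b. b \<in> B" y]
      by (simp_all add: eventually_nhds_in_open)
    from near[rule_format, OF eventually_conj[OF this]]
    obtain x' y' where "(x', y') \<in> R" "x' \<in> A" "y' \<in> B"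
      by auto
    then have "(x', y') \<in> T"
      using AB(5) assms(1) unfolding W(2) by blast
    with \<open>(x', y') \<in> R\<close> show ?thesis
      by blast
  qed
  then show "(x, y) \<in> closure2 X R"
    unfolding in_closure_of topspace_euclidean_subtopology using assms(2,3) by blast
qed

lemma closure2_subset: "closure2 X R \<subseteq> X \<times> X"
  using closure_of_subset_topspace[of "top_of_set (X \<times> X)" R] by simp

lemma closure2_superset: "R \<subseteq> X \<times> X \<Longrightarrow> R \<subseteq> closure2 X R"
  by (simp add: closure_of_subset)

lemma closure_nearby:
  assumes "x \<in> closure S" "eventually P (nhds x)"
  obtains y where "y \<in> S" "P y"
  using assms unfolding closure_iff_nhds_not_empty eventually_nhds
  by (metis disjoint_iff subset_refl)

text \<open>The map \<open>f\<close> acts continuously on the square through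
  \<open>map_prod f f\<close>, so it carries the closure of \<open>R\<close> into the closure of the
  image of \<open>R\<close>. This is meant for the source and target maps, whose continuity is part
  of being a completion.\<close>

lemma closure2_image:
  assumes f: "continuous_on X f" "f \<in> X \<rightarrow> X" and R: "R \<subseteq> X \<times> X"
    and fR: "\<And>x y. (x, y) \<in> R \<Longrightarrow> (f x, f y) \<in> R" and xy: "(x, y) \<in> closure2 X R"
  shows "(f x, f y) \<in> closure2 X R"
proof -
  have "continuous_map (top_of_set (X \<times> X)) (top_of_set (X \<times> X)) (map_prod f f)"
    using f by (auto simp: map_prod_def case_prod_unfold
        intro!: continuous_intros continuous_on_compose2[OF f(1)])
  then have "map_prod f f ` closure2 X R \<subseteq> closure2 X (map_prod f f ` R)"
    by (rule continuous_map_image_closure_subset)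
  also have "\<dots> \<subseteq> closure2 X R"
    using fR by (intro closure_of_mono) auto
  finally show ?thesis
    using xy by force
qed

lemma Hausdorff_separating_entourage:
  fixes X :: "'a::uniform_space set"
  assumes "Hausdorff_space (top_of_set X)" "x \<in> X" "y \<in> X" "x \<noteq> y"
  obtains E where "entourage_on X E" "(x, y) \<notin> E"
proof -
  obtain U V where UV: "openin (top_of_set X) U" "openin (top_of_set X) V" "x \<in> U" "y \<in> V"
    "disjnt U V"
    using assms unfolding Hausdorff_space_def by (metis topspace_euclidean_subtopology)
  then obtain W where W: "open W" "U = X \<inter> W"
    by (auto simp: openin_open)
  \<comment> \<open>The open set \<open>W\<close> contains \<open>x\<close> and misses
    \<open>y\<close>, so constraining only the pairs that start at \<open>x\<close> already excludes
    \<open>(x, y)\<close>.\<close>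
  have "eventually (\<lambda>(a, b). a = x \<longrightarrow> b \<in> W) uniformity"
    using W UV eventually_nhds_uniformity[of "\<lambda>b. b \<in> W" x] by (simp add: eventually_nhds_in_open)
  then have "entourage_on X {(a, b) \<in> X \<times> X. a = x \<longrightarrow> b \<in> W}"
    unfolding entourage_on_iff by (auto elim: eventually_mono)
  moreover have "y \<notin> W"
    using UV W assms by (auto simp: disjnt_iff)
  ultimately show thesis
    using that by blast
qed

section \<open>Entourages of a space and of a dense subspace, without graph structure\<close>

locale dense_subspace =
  fixes Y X :: "'a::uniform_space set"
  assumes sub: "Y \<subseteq> X" and dense: "X \<subseteq> closure Y"
begin

lemma entourage_nearby:
  assumes "entourage_on X E" "x \<in> X"
  obtains y where "y \<in> Y" "(x, y) \<in> E"
proof -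
  obtain P where P: "eventually P uniformity"
    "\<And>x y. P (x, y) \<Longrightarrow> x \<in> X \<Longrightarrow> y \<in> X \<Longrightarrow> (x, y) \<in> E"
    using entourage_onE[OF assms(1)] by blast
  obtain y where "y \<in> Y" "P (x, y)"
    using closure_nearby[OF _ eventually_nhds_uniformityI[OF P(1)]] assms dense by blast
  then show thesis
    using that P(2) assms sub by blast
qed

text \<open>If \<open>x\<close> and \<open>y\<close> are \<open>D\<close>-close, sufficiently good
  approximants of them in \<open>Y\<close> are joined by three \<open>D\<close>-steps, hence lie in
  \<open>R\<close>.\<close>

lemma entourage_on_closure2:
  assumes R: "entourage_on Y R"
  shows "entourage_on X (closure2 X R)"
proof -
  have RX: "R \<subseteq> X \<times> X"
    using R sub unfolding entourage_on_iff by blast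
  obtain P where P: "eventually P uniformity"
    "\<And>x y. P (x, y) \<Longrightarrow> x \<in> Y \<Longrightarrow> y \<in> Y \<Longrightarrow> (x, y) \<in> R"
    using entourage_onE[OF R] by blast
  obtain D where D: "eventually D uniformity" "\<And>x y. D (x, y) \<Longrightarrow> D (y, x)"
    "\<And>w x y z. D (w, x) \<Longrightarrow> D (x, y) \<Longrightarrow> D (y, z) \<Longrightarrow> P (w, z)"
    using uniformity_thirdE[OF P(1)] by metis
  have "(x, y) \<in> closure2 X R" if xy: "x \<in> X" "y \<in> X" "D (x, y)" for x y
    unfolding in_closure2_iff[OF RX xy(1,2)]
  proof (intro allI impI)
    \<comment> \<open>Approximants are taken within \<open>D\<close> and \<open>Q\<close> at once:
      \<open>D\<close> forces the pair into \<open>R\<close>, and \<open>Q\<close> meets the closure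
      test.\<close>
    fix Q :: "'a \<times> 'a \<Rightarrow> bool" assume "eventually Q uniformity"
    with D(1) have ev: "eventually (\<lambda>p. D p \<and> Q p) uniformity"
      by (rule eventually_conj)
    obtain x' where x': "x' \<in> Y" "D (x, x')" "Q (x, x')"
      using closure_nearby[OF _ eventually_nhds_uniformityI[OF ev]] xy dense by blast
    obtain y' where y': "y' \<in> Y" "D (y, y')" "Q (y, y')"
      using closure_nearby[OF _ eventually_nhds_uniformityI[OF ev]] xy dense by blast
    have "(x', y') \<in> R"
      using D(2,3) P(2) x' y' xy by blast
    then show "\<exists>(x', y')\<in>R. Q (x, x') \<and> Q (y, y')"
      using x' y' by blast
  qed
  then have "eventually (\<lambda>p. p \<in> X \<times> X \<longrightarrow> p \<in> closure2 X R) uniformity"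
    using D(1) by (auto elim!: eventually_mono)
  then show ?thesis
    using closure2_subset unfolding entourage_on_iff by blast
qed

text \<open>An equivalence relation that is an entourage is closed in \<open>Y \<times> Y\<close>:
  points of \<open>Y\<close> close to \<open>x\<close> or \<open>y\<close> stay in the
  \<open>R\<close>-class of \<open>x\<close> or \<open>y\<close>.\<close>

lemma closure2_Int:
  assumes R: "equiv Y R" "entourage_on Y R" and xy: "x \<in> Y" "y \<in> Y"
  shows "(x, y) \<in> closure2 X R \<longleftrightarrow> (x, y) \<in> R"
proof
  have RY: "R \<subseteq> Y \<times> Y" and RX: "R \<subseteq> X \<times> X"
    using R sub unfolding entourage_on_iff by blast+
  then show "(x, y) \<in> R \<Longrightarrow> (x, y) \<in> closure2 X R"
    using closure2_superset by blast
  assume cl: "(x, y) \<in> closure2 X R"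
  obtain P where P: "eventually P uniformity"
    "\<And>x y. P (x, y) \<Longrightarrow> x \<in> Y \<Longrightarrow> y \<in> Y \<Longrightarrow> (x, y) \<in> R"
    using entourage_onE[OF R(2)] by blast
  obtain x' y' where "(x', y') \<in> R" "P (x, x')" "P (y, y')"
    using cl P(1) in_closure2_iff[OF RX] xy sub by blast
  then have "(x, x') \<in> R" "(x', y') \<in> R" "(y, y') \<in> R"
    using P(2) RY xy by auto
  then show "(x, y) \<in> R"
    using R(1) by (meson equivE symD transD)
qed

lemma equiv_closure2:
  assumes R: "equiv Y R" "entourage_on Y R"
  shows "equiv X (closure2 X R)"
proof (rule equivI)
  have RY: "R \<subseteq> Y \<times> Y" and RX: "R \<subseteq> X \<times> X"
    using R sub unfolding entourage_on_iff by blast+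
  note iff = in_closure2_iff[OF RX]
  show "closure2 X R \<subseteq> X \<times> X"
    by (rule closure2_subset)
  show "refl_on X (closure2 X R)"
  proof (rule refl_onI)
    fix x assume "x \<in> X"
    then show "(x, x) \<in> closure2 X R"
      \<comment> \<open>The closure is an entourage, so it contains the diagonal of
        \<open>X\<close>.\<close>
      using entourage_on_closure2[OF R(2)] uniformity_refl unfolding entourage_on_iff by blast
  qed
  show "sym (closure2 X R)"
  proof (rule symI)
    fix x y assume xy: "(x, y) \<in> closure2 X R"
    then have X: "x \<in> X" "y \<in> X"
      using closure2_subset by blast+
    have "sym R"
      using R(1) by (simp add: equiv_def)
    then show "(y, x) \<in> closure2 X R"
      using xy unfolding iff[OF X] iff[OF X(2,1)] by (fast dest: symD)
  qed
  show "trans (closure2 X R)"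
  proof (rule transI)
    fix x y z assume xyz: "(x, y) \<in> closure2 X R" "(y, z) \<in> closure2 X R"
    then have X: "x \<in> X" "y \<in> X" "z \<in> X"
      using closure2_subset by blast+
    obtain P where P: "eventually P uniformity"
      "\<And>x y. P (x, y) \<Longrightarrow> x \<in> Y \<Longrightarrow> y \<in> Y \<Longrightarrow> (x, y) \<in> R"
      using entourage_onE[OF R(2)] by blast
    obtain D where D: "eventually D uniformity" "\<And>x y. D (x, y) \<Longrightarrow> D (y, x)"
      "\<And>x y z. D (x, y) \<Longrightarrow> D (y, z) \<Longrightarrow> P (x, z)"
      using uniformity_thirdE[OF P(1)] by metis
    show "(x, z) \<in> closure2 X R"
      unfolding iff[OF X(1,3)]
    proof (intro allI impI)
      fix Q :: "'a \<times> 'a \<Rightarrow> bool" assume "eventually Q uniformity"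
      with D(1) have ev: "eventually (\<lambda>p. D p \<and> Q p) uniformity"
        by (rule eventually_conj)
      obtain x' y' where 1: "(x', y') \<in> R" "D (y, y')" "Q (x, x')"
        using xyz(1) ev unfolding iff[OF X(1,2)] by blast
      obtain y'' z' where 2: "(y'', z') \<in> R" "D (y, y'')" "Q (z, z')"
        using xyz(2) ev unfolding iff[OF X(2,3)] by blast
      \<comment> \<open>The approximating pairs have different middle points. Both are
        \<open>D\<close>-close to \<open>y\<close>, so they are \<open>R\<close>-related and bridge
        the two pairs.\<close>
      have "(y', y'') \<in> R"
        using 1 2 D P(2) RY by blast
      then have "(x', z') \<in> R"
        using 1 2 R(1) by (meson equivE transD)
      then show "\<exists>(x', z')\<in>R. Q (x, x') \<and> Q (z, z')"
        using 1 2 by blast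
    qed
  qed
qed

text \<open>By density every class of the closure meets \<open>Y\<close>, so it is the saturation of
  an \<open>R\<close>-class. There are at most as many classes as before.\<close>

lemma finite_quotient_closure2:
  assumes R: "equiv Y R" "entourage_on Y R" and fin: "finite (Y // R)"
  shows "finite (X // closure2 X R)"
proof -
  note eq = equiv_closure2[OF R]
  have RX: "R \<subseteq> X \<times> X"
    using R sub unfolding entourage_on_iff by blast
  have "X // closure2 X R \<subseteq> (\<lambda>c. closure2 X R `` c) ` (Y // R)"
  proof
    fix c assume "c \<in> X // closure2 X R"
    then obtain x where x: "x \<in> X" "c = closure2 X R `` {x}"
      by (auto elim: quotientE)
    obtain y where y: "y \<in> Y" "(x, y) \<in> closure2 X R"
      using entourage_nearby[OF entourage_on_closure2[OF R(2)] x(1)] .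
    have "closure2 X R `` (R `` {y}) = closure2 X R `` {y}"
    proof (intro equalityI subsetI)
      fix z assume "z \<in> closure2 X R `` (R `` {y})"
      then obtain w where "(y, w) \<in> R" "(w, z) \<in> closure2 X R"
        by blast
      then have "(y, w) \<in> closure2 X R" "(w, z) \<in> closure2 X R"
        using closure2_superset[OF RX] by blast+
      moreover have "trans (closure2 X R)"
        using eq by (rule equivE)
      ultimately show "z \<in> closure2 X R `` {y}"
        by (auto dest: transD)
    next
      fix z assume "z \<in> closure2 X R `` {y}"
      moreover have "(y, y) \<in> R"
        using R(1) y(1) by (simp add: equiv_def refl_on_def)
      ultimately show "z \<in> closure2 X R `` (R `` {y})"
        by blast
    qed
    also have "\<dots> = c"
      using equiv_class_eq[OF eq y(2)] x(2) by simp
    finally have "c = closure2 X R `` (R `` {y})" ..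
    then show "c \<in> (\<lambda>c. closure2 X R `` c) ` (Y // R)"
      using quotientI[OF y(1)] by (rule image_eqI)
  qed
  then show ?thesis
    using fin finite_surj by blast
qed

text \<open>A pair in the closure of a \<open>D\<close>-small relation is joined by three
  \<open>D\<close>-steps. Since \<open>F\<close> is found before \<open>R\<close>, closing the
  members of a base on \<open>Y\<close> gives arbitrarily small entourages on
  \<open>X\<close>.\<close>

lemma ex_closure2_subset:
  assumes E: "entourage_on X E"
  obtains F where "entourage_on Y F" "\<And>R. R \<subseteq> F \<Longrightarrow> closure2 X R \<subseteq> E"
proof -
  obtain P where P: "eventually P uniformity"
    "\<And>x y. P (x, y) \<Longrightarrow> x \<in> X \<Longrightarrow> y \<in> X \<Longrightarrow> (x, y) \<in> E"
    using entourage_onE[OF E] by blast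
  obtain D where D: "eventually D uniformity" "\<And>x y. D (x, y) \<Longrightarrow> D (y, x)"
    "\<And>w x y z. D (w, x) \<Longrightarrow> D (x, y) \<Longrightarrow> D (y, z) \<Longrightarrow> P (w, z)"
    using uniformity_thirdE[OF P(1)] by metis
  show thesis
  proof
    show "entourage_on Y {p \<in> Y \<times> Y. D p}"
      using D(1) unfolding entourage_on_iff by (auto elim: eventually_mono)
    fix R assume R: "R \<subseteq> {p \<in> Y \<times> Y. D p}"
    then have RX: "R \<subseteq> X \<times> X"
      using sub by blast
    show "closure2 X R \<subseteq> E"
    proof clarify
      fix x y assume xy: "(x, y) \<in> closure2 X R"
      then have X: "x \<in> X" "y \<in> X"
        using closure2_subset by blast+
      obtain x' y' where "(x', y') \<in> R" "D (x, x')" "D (y, y')"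
        using xy D(1) unfolding in_closure2_iff[OF RX X] by blast
      then show "(x, y) \<in> E"
        using R D(2,3) P(2) X by blast
    qed
  qed
qed

section \<open>Traces of entourages on the dense subspace\<close>

lemma entourage_on_Int:
  assumes "entourage_on X S"
  shows "entourage_on Y (S \<inter> Y \<times> Y)"
  using assms sub unfolding entourage_on_iff by (auto elim: eventually_mono)

lemma equiv_Int:
  assumes "equiv X S"
  shows "equiv Y (S \<inter> Y \<times> Y)"
  using assms sub by (auto simp: equiv_def refl_on_def intro!: symI transI dest: symD transD)

lemma finite_quotient_Int:
  assumes "finite (X // S)"
  shows "finite (Y // (S \<inter> Y \<times> Y))"
proof -
  have "Y // (S \<inter> Y \<times> Y) \<subseteq> (\<lambda>c. c \<inter> Y) ` (X // S)"
  proof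
    fix c assume "c \<in> Y // (S \<inter> Y \<times> Y)"
    then obtain y where "y \<in> Y" "c = (S `` {y}) \<inter> Y"
      by (auto elim: quotientE)
    then show "c \<in> (\<lambda>c. c \<inter> Y) ` (X // S)"
      using quotientI[of y X S] sub by blast
  qed
  then show ?thesis
    using assms finite_surj by blast
qed

text \<open>With \<open>closure2_Int\<close> this makes closing and restricting mutually inverse.
  Both inclusions hold because \<open>S\<close>-classes are open in \<open>X\<close>: moving either
  coordinate slightly does not change membership in \<open>S\<close>, and density allows moving into
  \<open>Y\<close>.\<close>

lemma closure2_Int_eq:
  assumes S: "equiv X S" "entourage_on X S"
  shows "closure2 X (S \<inter> Y \<times> Y) = S"
proof -
  let ?R = "S \<inter> Y \<times> Y"
  have RX: "?R \<subseteq> X \<times> X"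
    using sub by blast
  have SX: "S \<subseteq> X \<times> X"
    using S(2) by (simp add: entourage_on_iff)
  have symS: "(y, x) \<in> S" if "(x, y) \<in> S" for x y
    using S(1) that by (meson equivE symD)
  have transS: "(x, z) \<in> S" if "(x, y) \<in> S" "(y, z) \<in> S" for x y z
    using S(1) that by (meson equivE transD)
  obtain P where P: "eventually P uniformity"
    "\<And>x y. P (x, y) \<Longrightarrow> x \<in> X \<Longrightarrow> y \<in> X \<Longrightarrow> (x, y) \<in> S"
    using entourage_onE[OF S(2)] by blast
  have "(x, y) \<in> closure2 X ?R \<longleftrightarrow> (x, y) \<in> S" if X: "x \<in> X" "y \<in> X" for x y
  proof
    assume "(x, y) \<in> closure2 X ?R"
    then obtain x' y' where 1: "(x', y') \<in> ?R" "P (x, x')" "P (y, y')"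
      using P(1) unfolding in_closure2_iff[OF RX X] by blast
    then have "x' \<in> X" "y' \<in> X"
      using RX by blast+
    then have "(x, x') \<in> S" "(x', y') \<in> S" "(y, y') \<in> S"
      using P(2) 1 X by blast+
    then show "(x, y) \<in> S"
      using symS transS by meson
  next
    assume xy: "(x, y) \<in> S"
    show "(x, y) \<in> closure2 X ?R"
      unfolding in_closure2_iff[OF RX X]
    proof (intro allI impI)
      fix Q :: "'a \<times> 'a \<Rightarrow> bool" assume "eventually Q uniformity"
      with P(1) have ev: "eventually (\<lambda>p. P p \<and> Q p) uniformity"
        by (rule eventually_conj)
      obtain x' where x': "x' \<in> Y" "P (x, x')" "Q (x, x')"
        using closure_nearby[OF _ eventually_nhds_uniformityI[OF ev]] X dense by blast
      obtain y' where y': "y' \<in> Y" "P (y, y')" "Q (y, y')"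
        using closure_nearby[OF _ eventually_nhds_uniformityI[OF ev]] X dense by blast
      have "(x, x') \<in> S" "(y, y') \<in> S"
        using x' y' P(2) X sub by blast+
      then have "(x', y') \<in> S"
        using xy symS transS by meson
      then have "(x', y') \<in> ?R"
        using x' y' by blast
      then show "\<exists>(x', y')\<in>?R. Q (x, x') \<and> Q (y, y')"
        using x' y' by blast
    qed
  qed
  then show ?thesis
    using closure2_subset[of X ?R] SX by (intro equalityI subrelI) blast+
qed

end

section \<open>The involution of the completion\<close>

locale completed_cofinite_graph =
  fixes G C :: "'a::uniform_space digraph" and i :: "'a \<Rightarrow> 'a"
  assumes cofinite: "cofinite_graph G i" and completion: "completion_of G C"
begin

abbreviation graph_entourage :: "('a \<times> 'a) set \<Rightarrow> bool" where
  "graph_entourage \<equiv> cofinite_graph_entourage G i"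

abbreviation bar :: "('a \<times> 'a) set \<Rightarrow> ('a \<times> 'a) set" where
  "bar \<equiv> closure2 (points C)"

sublocale dense_subspace "points G" "points C"
  using completion by unfold_locales (auto simp: completion_of_def sub_digraph_def)

lemma is_graph_G: "is_graph G i"
  using cofinite by (simp add: cofinite_graph_def)

lemma sub_digraph_G_C: "sub_digraph G C"
  using completion by (simp add: completion_of_def)

section \<open>Structure maps of the graph and of its completion\<close>

lemma G_simps:
  assumes "x \<in> points G"
  shows "src G x \<in> points G" "tgt G x \<in> points G" "i x \<in> points G"
    "src G x \<in> verts G" "tgt G x \<in> verts G"
    "src G (i x) = tgt G x" "tgt G (i x) = src G x" "i (i x) = x" "i x = x \<longleftrightarrow> x \<in> verts G"
    "src C x = src G x" "tgt C x = tgt G x" "x \<in> points C"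
proof -
  show "src G x \<in> verts G" "tgt G x \<in> verts G"
    using assms is_graph_G by (auto simp: is_graph_def directed_graph_def)
  then show "src G x \<in> points G" "tgt G x \<in> points G"
    using is_graph_G by (auto simp: is_graph_def directed_graph_def)
qed (use assms is_graph_G sub_digraph_G_C in \<open>auto simp: is_graph_def sub_digraph_def\<close>)

lemma G_verts:
  assumes "v \<in> verts G"
  shows "v \<in> points G" "src G v = v" "tgt G v = v" "i v = v" "v \<in> verts C"
  using assms is_graph_G sub_digraph_G_C
  by (auto simp: is_graph_def directed_graph_def sub_digraph_def)

lemma C_simps:
  assumes "x \<in> points C"
  shows "src C x \<in> points C" "tgt C x \<in> points C" "src C x \<in> verts C" "tgt C x \<in> verts C"
  using assms sub_digraph_G_C by (auto simp: directed_graph_def sub_digraph_def)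

lemma C_verts:
  assumes "v \<in> verts C"
  shows "v \<in> points C" "src C v = v" "tgt C v = v"
  using assms sub_digraph_G_C by (auto simp: directed_graph_def sub_digraph_def)

lemma graph_entourageD:
  assumes "graph_entourage R"
  shows "equiv (points G) R" "entourage_on (points G) R" "finite (points G // R)"
    "R \<subseteq> points G \<times> points G" "R \<subseteq> points C \<times> points C"
    "\<And>x y. (x, y) \<in> R \<Longrightarrow> (src G x, src G y) \<in> R"
    "\<And>x y. (x, y) \<in> R \<Longrightarrow> (tgt G x, tgt G y) \<in> R"
    "\<And>x y. (x, y) \<in> R \<Longrightarrow> (i x, i y) \<in> R"
    "\<And>x. (x, i x) \<in> R \<Longrightarrow> \<exists>v\<in>verts G. (v, x) \<in> R"
proof -
  note gr = assms[unfolded cofinite_graph_entourage_def graph_equiv_iff[OF is_graph_G]]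
  from gr show RG: "R \<subseteq> points G \<times> points G"
    by (simp add: entourage_on_def)
  then show "R \<subseteq> points C \<times> points C"
    using sub by blast
qed (use assms[unfolded cofinite_graph_entourage_def graph_equiv_iff[OF is_graph_G]] in blast)+

section \<open>Closures of the cofinite graph entourages\<close>

lemma entourage_bar: "graph_entourage R \<Longrightarrow> entourage_on (points C) (bar R)"
  by (simp add: entourage_on_closure2 graph_entourageD)

lemma equiv_bar: "graph_entourage R \<Longrightarrow> equiv (points C) (bar R)"
  by (simp add: equiv_closure2 graph_entourageD)

lemma bar_sym: "graph_entourage R \<Longrightarrow> (x, y) \<in> bar R \<Longrightarrow> (y, x) \<in> bar R"
  using equiv_bar by (meson equivE symD)

lemma bar_trans: "graph_entourage R \<Longrightarrow> (x, y) \<in> bar R \<Longrightarrow> (y, z) \<in> bar R \<Longrightarrow> (x, z) \<in> bar R"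
  using equiv_bar by (meson equivE transD)

lemma bar_iff:
  "graph_entourage R \<Longrightarrow> x \<in> points G \<Longrightarrow> y \<in> points G \<Longrightarrow> (x, y) \<in> bar R \<longleftrightarrow> (x, y) \<in> R"
  by (simp add: closure2_Int graph_entourageD)

lemma bar_superset: "graph_entourage R \<Longrightarrow> (x, y) \<in> R \<Longrightarrow> (x, y) \<in> bar R"
  using closure2_superset graph_entourageD(5) by blast

lemma bar_src: "graph_entourage R \<Longrightarrow> (x, y) \<in> bar R \<Longrightarrow> (src C x, src C y) \<in> bar R"
  and bar_tgt: "graph_entourage R \<Longrightarrow> (x, y) \<in> bar R \<Longrightarrow> (tgt C x, tgt C y) \<in> bar R"
proof -
  assume R: "graph_entourage R" and xy: "(x, y) \<in> bar R"
  have cont: "continuous_on (points C) (src C)" "continuous_on (points C) (tgt C)"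
    using completion by (auto simp: completion_of_def)
  have "(src C a, src C b) \<in> R" "(tgt C a, tgt C b) \<in> R" if "(a, b) \<in> R" for a b
    using graph_entourageD(4,6,7)[OF R] that G_simps(10,11) by auto
  then show "(src C x, src C y) \<in> bar R" "(tgt C x, tgt C y) \<in> bar R"
    using closure2_image[OF cont(1) _ graph_entourageD(5)[OF R] _ xy]
      closure2_image[OF cont(2) _ graph_entourageD(5)[OF R] _ xy] C_simps by auto
qed

text \<open>The entourage that \<open>ex_closure2_subset\<close> provides on the graph contains a
  cofinite graph entourage, whose closure then fits inside \<open>E\<close>.\<close>

lemma bar_base:
  assumes "entourage_on (points C) E"
  obtains R where "graph_entourage R" "bar R \<subseteq> E"
  using ex_closure2_subset[OF assms] cofinite unfolding cofinite_graph_def by metis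

text \<open>The completion is Hausdorff and the closures form a base, so they intersect in the
  diagonal. Equations in the completion are proved through this, one \<open>R\<close> at a
  time.\<close>

lemma bar_separating:
  assumes "x \<in> points C" "y \<in> points C" "\<And>R. graph_entourage R \<Longrightarrow> (x, y) \<in> bar R"
  shows "x = y"
proof (rule ccontr)
  assume "x \<noteq> y"
  moreover have "Hausdorff_space (top_of_set (points C))"
    using completion by (simp add: completion_of_def)
  ultimately obtain E where "entourage_on (points C) E" "(x, y) \<notin> E"
    using assms Hausdorff_separating_entourage by blast
  then show False
    using assms(3) bar_base by blast
qed

text \<open>Since the sets \<open>bar R\<close> form a base, this says that the graph of
  \<open>j\<close> lies in the closure of the graph of \<open>i\<close>. The condition is what
  compactness delivers, and any admissible involution satisfies it. Agreement with \<open>i\<close>,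
  uniform continuity and the graph axioms are derived from it.\<close>

definition extends_inv :: "('a \<Rightarrow> 'a) \<Rightarrow> bool" where
  "extends_inv j \<longleftrightarrow> j \<in> points C \<rightarrow> points C \<and>
     (\<forall>x\<in>points C. \<forall>R. graph_entourage R \<longrightarrow>
        (\<exists>g\<in>points G. (g, x) \<in> bar R \<and> (i g, j x) \<in> bar R))"

section \<open>Uniqueness of the extended involution and its graph axioms\<close>

lemma extends_invE:
  assumes "extends_inv j" "x \<in> points C" "graph_entourage R"
  obtains g where "g \<in> points G" "(g, x) \<in> bar R" "(i g, j x) \<in> bar R"
  using assms unfolding extends_inv_def by blast

lemma extends_inv_closed: "extends_inv j \<Longrightarrow> x \<in> points C \<Longrightarrow> j x \<in> points C"
  by (auto simp: extends_inv_def)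

text \<open>Approximants of \<open>x\<close> and \<open>y\<close> in the graph are
  \<open>R\<close>-related, and \<open>i\<close> preserves \<open>R\<close>. Two functions are
  treated together: \<open>j = j'\<close> gives uniform continuity, and \<open>x = y\<close> gives
  uniqueness.\<close>

lemma bar_inv_inv:
  assumes j: "extends_inv j" "extends_inv j'" and R: "graph_entourage R" and xy: "(x, y) \<in> bar R"
  shows "(j x, j' y) \<in> bar R"
proof -
  have X: "x \<in> points C" "y \<in> points C"
    using xy closure2_subset by blast+
  obtain g where g: "g \<in> points G" "(g, x) \<in> bar R" "(i g, j x) \<in> bar R"
    using extends_invE[OF j(1) X(1) R] .
  obtain h where h: "h \<in> points G" "(h, y) \<in> bar R" "(i h, j' y) \<in> bar R"
    using extends_invE[OF j(2) X(2) R] .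
  have "(g, h) \<in> bar R"
    using g h xy bar_sym[OF R] bar_trans[OF R] by blast
  then have "(i g, i h) \<in> bar R"
    using R g h bar_iff bar_superset graph_entourageD(8) by blast
  then show ?thesis
    using g h bar_sym[OF R] bar_trans[OF R] by blast
qed

lemma extends_inv_unique:
  assumes "extends_inv j" "extends_inv j'" "x \<in> points C"
  shows "j x = j' x"
proof (rule bar_separating)
  fix R assume R: "graph_entourage R"
  then have "(x, x) \<in> bar R"
    using equiv_bar assms(3) by (meson equivE refl_onD)
  then show "(j x, j' x) \<in> bar R"
    by (rule bar_inv_inv[OF assms(1,2) R])
qed (use assms extends_inv_closed in blast)+

lemma extends_inv_eq_on_G:
  assumes j: "extends_inv j" and x: "x \<in> points G"
  shows "j x = i x"
proof (rule bar_separating)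
  show "j x \<in> points C" "i x \<in> points C"
    using x sub G_simps(3)[OF x] extends_inv_closed[OF j] by blast+
  fix R assume R: "graph_entourage R"
  have "x \<in> points C"
    using x sub by blast
  then obtain g where g: "g \<in> points G" "(g, x) \<in> bar R" "(i g, j x) \<in> bar R"
    using extends_invE[OF j _ R] by blast
  then have "(i g, i x) \<in> bar R"
    using bar_iff[OF R g(1) x] bar_superset[OF R] graph_entourageD(8)[OF R] by blast
  then show "(j x, i x) \<in> bar R"
    by (rule bar_trans[OF R bar_sym[OF R g(3)]])
qed

text \<open>An approximant \<open>g\<close> of \<open>x\<close> satisfies
  \<open>(g, i g) \<in> R\<close>, so condition (ii) for \<open>R\<close> supplies a vertex already
  in the original graph.\<close>

lemma bar_vertex:
  assumes j: "extends_inv j" and R: "graph_entourage R" and x: "(x, j x) \<in> bar R"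
  shows "\<exists>v\<in>verts G. (v, x) \<in> bar R"
proof -
  have "x \<in> points C"
    using x closure2_subset by blast
  then obtain g where g: "g \<in> points G" "(g, x) \<in> bar R" "(i g, j x) \<in> bar R"
    using extends_invE[OF j _ R] by blast
  have "(g, i g) \<in> bar R"
    by (rule bar_trans[OF R g(2) bar_trans[OF R x bar_sym[OF R g(3)]]])
  then have "(g, i g) \<in> R"
    using bar_iff[OF R g(1) G_simps(3)[OF g(1)]] by simp
  then obtain v where "v \<in> verts G" "(v, g) \<in> bar R"
    using graph_entourageD(9)[OF R] bar_superset[OF R] by blast
  then show ?thesis
    using g bar_trans[OF R] by blast
qed

lemma is_graph_C:
  assumes j: "extends_inv j"
  shows "is_graph C j"
proof -
  note jC = extends_inv_closed[OF j]
  note jG = extends_inv_eq_on_G[OF j]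
  note jbar = bar_inv_inv[OF j j]
  have src: "src C (j x) = tgt C x" and tgt: "tgt C (j x) = src C x" and inv: "j (j x) = x"
    if x: "x \<in> points C" for x
  proof -
    have "(src C (j x), tgt C x) \<in> bar R \<and> (tgt C (j x), src C x) \<in> bar R \<and> (j (j x), x) \<in> bar R"
      if R: "graph_entourage R" for R
    proof -
      obtain g where g: "g \<in> points G" "(g, x) \<in> bar R" "(i g, j x) \<in> bar R"
        using extends_invE[OF j x R] .
      \<comment> \<open>The three maps respect \<open>bar R\<close>, so each identity at
        \<open>x\<close> follows modulo \<open>bar R\<close> from the same identity at the nearby
        \<open>g\<close>.\<close>
      have "(src C (i g), src C (j x)) \<in> bar R" "(tgt C (i g), tgt C (j x)) \<in> bar R"
        "(j (i g), j (j x)) \<in> bar R" "(src C g, src C x) \<in> bar R" "(tgt C g, tgt C x) \<in> bar R"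
        using g bar_src[OF R] bar_tgt[OF R] jbar[OF R] by blast+
      moreover have "src C (i g) = tgt C g" "tgt C (i g) = src C g" "j (i g) = g"
        using g(1) G_simps jG by simp_all
      ultimately show ?thesis
        using g(2) bar_sym[OF R] bar_trans[OF R] by metis
    qed
    then show "src C (j x) = tgt C x" "tgt C (j x) = src C x" "j (j x) = x"
      by (auto intro!: bar_separating C_simps jC x)
  qed
  have vert: "j x = x \<longleftrightarrow> x \<in> verts C" if x: "x \<in> points C" for x
  proof
    assume jx: "j x = x"
    \<comment> \<open>Every \<open>bar R\<close>-class of a fixed point contains a vertex
      \<open>v\<close>. As \<open>src C\<close> fixes \<open>v\<close>, the source of
      \<open>x\<close> is in the same class, and separation gives
      \<open>src C x = x\<close>.\<close>
    have "(src C x, x) \<in> bar R" if R: "graph_entourage R" for R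
    proof -
      have "(x, j x) \<in> bar R"
        using jx R x equiv_bar by (metis equivE refl_onD)
      then obtain v where v: "v \<in> verts G" "(v, x) \<in> bar R"
        using bar_vertex[OF j R] by blast
      then have "(v, src C x) \<in> bar R"
        using bar_src[OF R v(2)] G_verts C_verts by metis
      then show ?thesis
        using v bar_sym[OF R] bar_trans[OF R] by blast
    qed
    then have "src C x = x"
      using x C_simps by (auto intro!: bar_separating)
    then show "x \<in> verts C"
      using x C_simps by metis
  next
    assume xv: "x \<in> verts C"
    have "(j x, x) \<in> bar R" if R: "graph_entourage R" for R
    proof -
      obtain g where g: "g \<in> points G" "(g, x) \<in> bar R"
        using extends_invE[OF j x R] .
      \<comment> \<open>The approximant \<open>g\<close> need not be a vertex. Its source is one,
        and it is still close to \<open>src C x = x\<close>.\<close>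
      then have v: "(src G g, x) \<in> bar R"
        using bar_src[OF R g(2)] G_simps C_verts[OF xv] by metis
      have "(j (src G g), j x) \<in> bar R"
        using jbar[OF R v] .
      moreover have "j (src G g) = src G g"
        using g(1) G_simps G_verts jG by metis
      ultimately show ?thesis
        using v bar_sym[OF R] bar_trans[OF R] by metis
    qed
    then show "j x = x"
      using x jC by (auto intro!: bar_separating)
  qed
  have "directed_graph C"
    using sub_digraph_G_C by (simp add: sub_digraph_def)
  then show ?thesis
    using src tgt inv vert jC by (simp add: is_graph_def)
qed

lemma graph_entourage_bar:
  assumes j: "extends_inv j" and R: "graph_entourage R"
  shows "cofinite_graph_entourage C j (bar R)"
proof -
  have "\<exists>v\<in>verts C. (v, x) \<in> bar R" if "(x, j x) \<in> bar R" for x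
    using bar_vertex[OF j R that] G_verts by blast
  then have "graph_equiv C j (bar R)"
    unfolding graph_equiv_iff[OF is_graph_C[OF j]]
    using equiv_bar[OF R] bar_src[OF R] bar_tgt[OF R] bar_inv_inv[OF j j R] by blast
  moreover have "finite (points C // bar R)"
    using finite_quotient_closure2 graph_entourageD[OF R] by blast
  ultimately show ?thesis
    using entourage_bar[OF R] by (simp add: cofinite_graph_entourage_def)
qed

lemma cofinite_graph_C:
  assumes j: "extends_inv j"
  shows "cofinite_graph C j" "subgraph G i C j"
proof -
  have "Hausdorff_space (top_of_set (points C))"
    using completion by (simp add: completion_of_def)
  then show "cofinite_graph C j"
    unfolding cofinite_graph_def
    using is_graph_C[OF j] graph_entourage_bar[OF j] bar_base by metis
  show "subgraph G i C j"
    using is_graph_C[OF j] is_graph_G sub_digraph_G_C extends_inv_eq_on_G[OF j]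
    by (simp add: subgraph_def)
qed

text \<open>Continuity of \<open>j\<close> is hidden in the base of cofinite graph entourages: some
  \<open>S\<close> inside \<open>bar R\<close> is preserved by \<open>j\<close>, and a point
  \<open>g\<close> of the graph that is \<open>S\<close>-related to \<open>x\<close> is the required
  approximant.\<close>

lemma cofinite_graph_imp_extends_inv:
  assumes j: "cofinite_graph C j" "subgraph G i C j"
  shows "extends_inv j"
  unfolding extends_inv_def
proof (intro conjI ballI allI impI)
  have gr: "is_graph C j"
    using j by (simp add: cofinite_graph_def)
  then show "j \<in> points C \<rightarrow> points C"
    by (simp add: is_graph_def)
  fix x R assume x: "x \<in> points C" and R: "graph_entourage R"
  obtain S where S: "cofinite_graph_entourage C j S" "S \<subseteq> bar R"
    using j(1) entourage_bar[OF R] by (auto simp: cofinite_graph_def)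
  then have eq: "graph_equiv C j S" and ent: "entourage_on (points C) S"
    by (auto simp: cofinite_graph_entourage_def)
  obtain g where g: "g \<in> points G" "(x, g) \<in> S"
    using entourage_nearby[OF ent x] .
  then have gx: "(g, x) \<in> S"
    using eq by (meson graph_equiv_def equivE symD)
  then have "(j g, j x) \<in> S"
    using eq unfolding graph_equiv_iff[OF gr] by blast
  moreover have "j g = i g"
    using j(2) g by (simp add: subgraph_def)
  ultimately show "\<exists>g\<in>points G. (g, x) \<in> bar R \<and> (i g, j x) \<in> bar R"
    using g gx S by auto
qed

section \<open>Correspondence of the cofinite graph entourages\<close>

lemma graph_entourage_Int:
  assumes j: "extends_inv j" and S: "cofinite_graph_entourage C j S"
  shows "graph_entourage (S \<inter> points G \<times> points G)"
proof -
  have eq: "equiv (points C) S"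
    and SS: "\<And>x y. (x, y) \<in> S \<Longrightarrow> (src C x, src C y) \<in> S \<and> (tgt C x, tgt C y) \<in> S \<and> (j x, j y) \<in> S"
    and Sv: "\<And>x. (x, j x) \<in> S \<Longrightarrow> \<exists>v\<in>verts C. (v, x) \<in> S"
    and fin: "finite (points C // S)" and ent: "entourage_on (points C) S"
    using S unfolding cofinite_graph_entourage_def graph_equiv_iff[OF is_graph_C[OF j]] by blast+
  let ?R = "S \<inter> points G \<times> points G"
  have "\<exists>v\<in>verts G. (v, x) \<in> ?R" if x: "(x, i x) \<in> ?R" for x
  proof -
    have xG: "x \<in> points G" "j x = i x"
      using x extends_inv_eq_on_G[OF j] by auto
    then obtain v where v: "v \<in> verts C" "(v, x) \<in> S"
      using x Sv[of x] by auto
    \<comment> \<open>The vertex \<open>v\<close> may lie outside the original graph. It is fixed by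
      \<open>src C\<close>, so \<open>src G x\<close> is in the same class and can replace
      it.\<close>
    then have "(v, src G x) \<in> S"
      using SS C_verts xG G_simps by metis
    then have "(src G x, x) \<in> S"
      using v eq by (meson equivE symD transD)
    then show ?thesis
      using xG G_simps by blast
  qed
  moreover have "(src G x, src G y) \<in> ?R \<and> (tgt G x, tgt G y) \<in> ?R \<and> (i x, i y) \<in> ?R"
    if "(x, y) \<in> ?R" for x y
  proof -
    from that have "x \<in> points G" "y \<in> points G" "(x, y) \<in> S"
      by auto
    then show ?thesis
      using SS[of x y] G_simps extends_inv_eq_on_G[OF j] by simp
  qed
  ultimately have "graph_equiv G i ?R"
    unfolding graph_equiv_iff[OF is_graph_G] using equiv_Int[OF eq] by blast
  then show ?thesis
    using finite_quotient_Int[OF fin] entourage_on_Int[OF ent]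
    by (simp add: cofinite_graph_entourage_def)
qed

lemma graph_entourages_C:
  assumes j: "extends_inv j"
  shows "{S. cofinite_graph_entourage C j S} = {bar R | R. graph_entourage R}"
proof (intro equalityI subsetI)
  fix S assume "S \<in> {S. cofinite_graph_entourage C j S}"
  then have S: "cofinite_graph_entourage C j S"
    by simp
  then have "bar (S \<inter> points G \<times> points G) = S"
    by (intro closure2_Int_eq) (auto simp: cofinite_graph_entourage_def graph_equiv_def)
  then show "S \<in> {bar R | R. graph_entourage R}"
    using graph_entourage_Int[OF j S] by blast
qed (use graph_entourage_bar[OF j] in blast)

lemma ex_extends_inv: "\<exists>j. extends_inv j"
proof -
  define X where "X = points C"
  define L where "L = (\<lambda>g. (g, i g)) ` points G"
  define J where "J = closure2 X L"
  have LX: "L \<subseteq> X \<times> X"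
    using G_simps by (auto simp: L_def X_def)
  have haus: "Hausdorff_space (top_of_set X)" and "compact X"
    using completion by (auto simp: completion_of_def X_def)
  then have "compact_space (top_of_set (X \<times> X))"
    by (simp add: compact_Times compact_space_subtopology)
  then have "compactin (top_of_set (X \<times> X)) J"
    unfolding J_def by (intro closedin_compact_space) auto
  moreover have "continuous_map (top_of_set (X \<times> X)) (top_of_set X) fst"
    by (auto intro!: continuous_intros)
  ultimately have "compactin (top_of_set X) (fst ` J)"
    by (rule image_compactin)
  \<comment> \<open>The projection of the compact set \<open>J\<close> is closed and contains the
    dense set \<open>points G\<close>, so it is all of \<open>X\<close>.\<close>
  then have "closedin (top_of_set X) (fst ` J)"
    using haus compactin_imp_closedin by blast
  then obtain K where K: "closed K" "fst ` J = X \<inter> K"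
    by (auto simp: closedin_closed)
  have "L \<subseteq> J"
    unfolding J_def using LX by (rule closure2_superset)
  then have "points G \<subseteq> fst ` J"
    unfolding L_def by (metis (no_types, lifting) fst_conv image_eqI image_subset_iff subsetI)
  then have "closure (points G) \<subseteq> K"
    using K by (intro closure_minimal) blast+
  then have "X \<subseteq> fst ` J"
    using K(2) dense unfolding X_def by blast
  then have "\<exists>y. (x, y) \<in> J" if "x \<in> X" for x
    using that by (metis imageE prod.collapse subsetD)
  \<comment> \<open>Any choice of second coordinates will do; \<open>extends_inv_unique\<close>
    shows afterwards that there was only one on \<open>points C\<close>.\<close>
  then obtain j where j: "\<And>x. x \<in> X \<Longrightarrow> (x, j x) \<in> J"
    by metis
  have "extends_inv j"
    unfolding extends_inv_def
  proof (intro conjI ballI allI impI)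
    show "j \<in> points C \<rightarrow> points C"
      using j closure2_subset[of X L] unfolding J_def X_def by blast
    fix x R assume x: "x \<in> points C" and R: "graph_entourage R"
    have X: "x \<in> X" "j x \<in> X"
      using x j closure2_subset[of X L] unfolding J_def X_def by blast+
    obtain P where P: "eventually P uniformity"
      "\<And>x y. P (x, y) \<Longrightarrow> x \<in> points C \<Longrightarrow> y \<in> points C \<Longrightarrow> (x, y) \<in> bar R"
      using entourage_onE[OF entourage_bar[OF R]] by blast
    have "(x, j x) \<in> closure2 X L"
      using j[OF X(1)] by (simp add: J_def)
    from in_closure2_iff[OF LX X, THEN iffD1, rule_format, OF this P(1)]
    obtain g where g: "g \<in> points G" "P (x, g)" "P (j x, i g)"
      by (auto simp: L_def)
    then have "g \<in> points C" "i g \<in> points C"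
      using G_simps(3,12) sub by blast+
    then have "(x, g) \<in> bar R" "(j x, i g) \<in> bar R"
      using P(2) X g(2,3) by (simp_all add: X_def)
    then show "\<exists>g\<in>points G. (g, x) \<in> bar R \<and> (i g, j x) \<in> bar R"
      using g bar_sym[OF R] by blast
  qed
  then show ?thesis
    by blast
qed

end

theorem theorem6p2:
  fixes G C :: "'a::uniform_space digraph" and i :: "'a \<Rightarrow> 'a"
  assumes "cofinite_graph G i" and "completion_of G C"
  shows "(\<exists>!j. j \<in> extensional (points C) \<and> cofinite_graph C j \<and> subgraph G i C j) \<and>
    (\<forall>j. cofinite_graph C j \<and> subgraph G i C j \<longrightarrow>
      {S. cofinite_graph_entourage C j S} =
      {top_of_set (points C \<times> points C) closure_of R | R. cofinite_graph_entourage G i R})"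
proof -
  interpret completed_cofinite_graph G C i
    using assms by unfold_locales
  obtain k where k: "extends_inv k"
    using ex_extends_inv by blast
  \<comment> \<open>Only values on \<open>points C\<close> are meaningful. Setting
    \<open>undefined\<close> elsewhere makes uniqueness an equality of total functions.\<close>
  define j where "j = restrict k (points C)"
  have j: "extends_inv j"
    using k by (auto simp: extends_inv_def j_def)
  have "\<exists>!j. j \<in> extensional (points C) \<and> cofinite_graph C j \<and> subgraph G i C j"
  proof (rule ex1I[of _ j])
    show "j \<in> extensional (points C) \<and> cofinite_graph C j \<and> subgraph G i C j"
      using cofinite_graph_C[OF j] by (simp add: j_def)
    fix j' assume j': "j' \<in> extensional (points C) \<and> cofinite_graph C j' \<and> subgraph G i C j'"
    then have "extends_inv j'"
      using cofinite_graph_imp_extends_inv by blast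
    then have "j' x = j x" if "x \<in> points C" for x
      using extends_inv_unique j that by blast
    then show "j' = j"
      using j' by (intro extensionalityI[of _ "points C"]) (auto simp: j_def)
  qed
  then show ?thesis
    using graph_entourages_C cofinite_graph_imp_extends_inv by blast
qed

end
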